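(* Let $f\colon\mathbb{R}^d\to\mathbb{R}$ be $C^2$ with $L$-Lipschitz continuous gradient and let $(\alpha_k)_{k\ge0}$ be a sequence of step sizes in $(0,1/L)$. If $\alpha_{\max}:=\sup_{k\ge0}\alpha_k<1/L$ and $\sum_{k=0}^\infty\alpha_k=\infty$, then the proximal point method $x_{k+1}=g_k(x_k)$, $k\ge0$, with $$g_k(x)=\operatorname*{arg\,min}_{z\in\mathbb{R}^d}\Big[f(z)+\frac{1}{2\alpha_k}\|z-x\|_2^2\Big],$$ avoids the strict saddle points of $f$.
   Context: The maps $g_k$ are well defined for $\alpha_k\in(0,1/L)$, since then the objective $z\mapsto f(z)+\frac1{2\alpha_k}\|z-x\|_2^2$ is strongly convex and has a unique minimizer. A strict saddle point of $f$ is a point $x^\ast$ with $\nabla f(x^\ast)=0$ such that the Hessian $\nabla^2 f(x^\ast)$ has at least one negative eigenvalue. The system $(g_k)_{k\ge0}$ avoids a set $S\subseteq\mathbb{R}^d$ if the set of initial points $x_0\in\mathbb{R}^d$ for which the trajectory $x_{k+1}=g_k(x_k)$, $k\ge0$, converges to some point of $S$ has Lebesgue measure zero. *)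

theory Defs
  imports "HOL-Analysis.Analysis"
begin

definition grad :: "('a::real_inner \<Rightarrow> real) \<Rightarrow> 'a \<Rightarrow> 'a" where
  "grad f x = (THE D. GDERIV f x :> D)"

definition hessian :: "(real ^ 'n \<Rightarrow> real) \<Rightarrow> real ^ 'n \<Rightarrow> real ^ 'n ^ 'n" where
  "hessian f x = jacobian (grad f) (at x)"

text \<open>The explicit differentiability conditions are needed because \<^const>\<open>grad\<close> and
  \<^const>\<open>hessian\<close> are total functions, with unspecified values where the derivative does not exist.
  Continuity of the gradient follows from its differentiability.\<close>

definition C2 :: "(real ^ 'n \<Rightarrow> real) \<Rightarrow> bool" where
  "C2 f \<longleftrightarrow> (\<forall>x. f differentiable at x) \<and> (\<forall>x. grad f differentiable at x)
    \<and> continuous_on UNIV (hessian f)"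

definition eigenvalue :: "real ^ 'n ^ 'n \<Rightarrow> real \<Rightarrow> bool" where
  "eigenvalue A c \<longleftrightarrow> (\<exists>v. v \<noteq> 0 \<and> A *v v = c *\<^sub>R v)"

definition strict_saddle :: "(real ^ 'n \<Rightarrow> real) \<Rightarrow> real ^ 'n \<Rightarrow> bool" where
  "strict_saddle f x \<longleftrightarrow> grad f x = 0 \<and> (\<exists>c<0. eigenvalue (hessian f x) c)"

text \<open>\<^const>\<open>arg_min_on\<close> chooses some minimizer. It is the unique one whenever the gradient of \<open>f\<close> is
  \<open>L\<close>-Lipschitz and \<open>0 < a < 1 / L\<close>, as the objective is then strongly convex.\<close>

definition prox_step :: "('a::real_normed_vector \<Rightarrow> real) \<Rightarrow> real \<Rightarrow> 'a \<Rightarrow> 'a" where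
  "prox_step f a x = arg_min_on (\<lambda>z. f z + 1 / (2 * a) * (norm (z - x))\<^sup>2) UNIV"

primrec trajectory :: "(nat \<Rightarrow> 'a \<Rightarrow> 'a) \<Rightarrow> 'a \<Rightarrow> nat \<Rightarrow> 'a" where
  "trajectory g x0 0 = x0"
| "trajectory g x0 (Suc k) = g k (trajectory g x0 k)"

text \<open>Here \<^const>\<open>lebesgue\<close> is the completed Lebesgue measure, so membership in
  \<open>null_sets lebesgue\<close> does not require the set to be Borel.\<close>

definition avoids :: "(nat \<Rightarrow> real ^ 'n \<Rightarrow> real ^ 'n) \<Rightarrow> (real ^ 'n) set \<Rightarrow> bool" where
  "avoids g S \<longleftrightarrow> {x0. \<exists>x\<in>S. trajectory g x0 \<longlonglongrightarrow> x} \<in> null_sets lebesgue"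

end

theory Submission
  imports Defs
begin

text \<open>
  The optimality condition for the proximal step reads \<open>g\<^sub>k x + \<alpha>\<^sub>k \<nabla>f (g\<^sub>k x) = x\<close>. So \<open>g\<^sub>k\<close> has the
  Lipschitz left inverse \<open>z \<mapsto> z + \<alpha>\<^sub>k \<nabla>f z\<close>, preimages of null sets under the trajectory maps are
  null, and it is enough to see that the points which some trajectory occupies at time \<open>K\<close> form a null
  set if the trajectory remains close to a fixed strict saddle from then on. Countably many of the resulting
  neighbourhoods cover all saddles.

  The local claim is proved without constructing a centre-stable manifold. Let \<open>H\<close> be the Hessian at
  the saddle, \<open>\<nu> < 0\<close> an eigenvalue with eigenvector \<open>v\<close>, and let \<open>\<mu>\<close> lie strictly between \<open>\<nu>\<close> and
  \<open>0\<close> without being an eigenvalue. Put \<open>A = H - \<mu> I\<close> and \<open>Q d = d \<bullet> A d\<close>. The difference \<open>d\<^sub>k\<close> of two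
  trajectories near the saddle satisfies \<open>d\<^sub>k = (I + \<alpha>\<^sub>k H) d\<^sub>k\<^sub>+\<^sub>1\<close> up to an error that is small compared
  with \<open>\<alpha>\<^sub>k \<bar>d\<^sub>k\<^sub>+\<^sub>1\<bar>\<close>. Expanding \<open>Q d\<^sub>k\<close> produces a surplus of at least
  \<open>2 \<alpha>\<^sub>k (1 - \<alpha>\<^sub>k L) \<bar>A d\<^sub>k\<^sub>+\<^sub>1\<bar>\<^sup>2\<close>, which
  absorbs the error because \<open>A\<close> is injective and \<open>sup \<alpha>\<^sub>k < 1 / L\<close>. The outcome is
  \<open>Q d\<^sub>k \<ge> (1 + \<alpha>\<^sub>k \<mu>)\<^sup>2 Q d\<^sub>k\<^sub>+\<^sub>1\<close> (\<open>implicit_step_expands_form\<close>).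

  If \<open>Q d\<^sub>K\<close> were negative, \<open>- Q d\<^sub>k\<close> would grow by a factor of at least \<open>1 + \<alpha>\<^sub>k \<bar>\<mu>\<bar>\<close> in each step,
  hence without bound since \<open>\<Sum> \<alpha>\<^sub>k = \<infinity>\<close>, although both trajectories remain in a ball
  (\<open>bounded_expanding_sequence_nonpos\<close>). So no difference of two points of the local set lies in the
  open cone \<open>Q < 0\<close>. This cone contains \<open>v\<close>, so the set is a Lipschitz graph over a part of the
  hyperplane orthogonal to \<open>v\<close> and therefore null (\<open>negligible_outside_cone\<close>).\<close>

section \<open>The gradient and its derivative\<close>

lemma GDERIV_grad:
  fixes f :: "'a::euclidean_space \<Rightarrow> real"
  assumes "f differentiable at x"
  shows "GDERIV f x :> grad f x"
proof -
  obtain f' where f': "(f has_derivative f') (at x)"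
    using assms unfolding differentiable_def by blast
  then have "linear f'"
    by (simp add: has_derivative_linear)
  then have "f' = (\<lambda>h. h \<bullet> adjoint f' 1)"
    using adjoint_works[of f' _ 1] by (intro ext) simp
  then have deriv: "GDERIV f x :> adjoint f' 1"
    unfolding gderiv_def by (rule has_derivative_eq_rhs[OF f'])
  have uniq: "D = E" if "GDERIV f x :> D" "GDERIV f x :> E" for D E
    using fun_cong[OF has_derivative_unique[OF that[unfolded gderiv_def]]] vector_eq_rdot[of D E]
    by (simp add: inner_commute)
  show ?thesis
    unfolding grad_def by (rule theI[of "\<lambda>D. GDERIV f x :> D", OF deriv]) (rule uniq[OF _ deriv])
qed

lemma hessian_has_derivative:
  assumes "C2 f"
  shows "(grad f has_derivative (*v) (hessian f x)) (at x)"
  using assms jacobian_works[of "grad f" "at x"] unfolding C2_def hessian_def by simp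

lemma GDERIV_along_line:
  fixes f :: "'a::real_inner \<Rightarrow> real"
  assumes "\<And>x. GDERIV f x :> F x"
  shows "((\<lambda>t. f (x + t *\<^sub>R u)) has_real_derivative u \<bullet> F (x + t *\<^sub>R u)) (at t)"
proof -
  have "((\<lambda>t. x + t *\<^sub>R u) has_derivative (\<lambda>h. h *\<^sub>R u)) (at t)"
    by (auto intro!: derivative_eq_intros)
  from has_derivative_compose[OF this assms[unfolded gderiv_def]]
  show ?thesis
    by (simp add: has_field_derivative_def mult_commute_abs)
qed

text \<open>The mean value theorem in direction \<open>u\<close> turns the second difference into \<open>s\<close> times a difference of
gradients at two points within \<open>s (\<bar>u\<bar> + \<bar>v\<bar>)\<close> of \<open>x\<close>. Both are compared with the derivative of \<open>F\<close>
at the single point \<open>x\<close>, so differentiability at \<open>x\<close> suffices.\<close>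

lemma second_difference_estimate:
  fixes f :: "'a::real_inner \<Rightarrow> real"
  assumes grad: "\<And>x. GDERIV f x :> F x" and "linear H"
    and approx: "\<And>y. norm (y - x) < \<delta> \<Longrightarrow> norm (F y - F x - H (y - x)) \<le> e * norm (y - x)"
    and s: "s > 0" "s * (norm u + norm v) < \<delta>" and "e > 0"
  shows "\<bar>f (x + s *\<^sub>R u + s *\<^sub>R v) - f (x + s *\<^sub>R u) - f (x + s *\<^sub>R v) + f x - s\<^sup>2 * (u \<bullet> H v)\<bar>
    \<le> s\<^sup>2 * (2 * e * (norm u + norm v)\<^sup>2)"
proof -
  let ?N = "norm u + norm v"
  let ?\<phi> = "\<lambda>t. f (x + s *\<^sub>R v + t *\<^sub>R u) - f (x + t *\<^sub>R u)"
  have "(?\<phi> has_real_derivative u \<bullet> F (x + s *\<^sub>R v + t *\<^sub>R u) - u \<bullet> F (x + t *\<^sub>R u)) (at t)" for t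
    by (intro DERIV_diff GDERIV_along_line grad)
  then have "\<exists>\<xi>>0. \<xi> < s \<and> ?\<phi> s - ?\<phi> 0 = (s - 0) * (u \<bullet> F (x + s *\<^sub>R v + \<xi> *\<^sub>R u) - u \<bullet> F (x + \<xi> *\<^sub>R u))"
    by (rule MVT2[OF s(1)])
  then obtain \<xi> where \<xi>: "0 < \<xi>" "\<xi> < s"
    and mvt: "?\<phi> s - ?\<phi> 0 = s * (u \<bullet> F (x + s *\<^sub>R v + \<xi> *\<^sub>R u) - u \<bullet> F (x + \<xi> *\<^sub>R u))"
    by auto
  let ?r = "\<lambda>y. F y - F x - H (y - x)"
  let ?y = "x + s *\<^sub>R v + \<xi> *\<^sub>R u" and ?z = "x + \<xi> *\<^sub>R u"
  have xiu: "\<xi> * norm u \<le> s * norm u"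
    using \<xi> by (simp add: mult_right_mono)
  have "norm (?y - x) \<le> s * norm v + \<xi> * norm u"
    using norm_triangle_ineq[of "s *\<^sub>R v" "\<xi> *\<^sub>R u"] \<xi> s by simp
  then have ny: "norm (?y - x) \<le> s * ?N"
    using xiu by (simp add: algebra_simps)
  have "norm (?z - x) = \<xi> * norm u" "0 \<le> s * norm v"
    using \<xi> s by simp_all
  then have nz: "norm (?z - x) \<le> s * ?N"
    using xiu unfolding distrib_left by linarith
  have ry: "norm (?r ?y) \<le> e * (s * ?N)"
    using approx[of ?y] ny s mult_left_mono[OF ny, of e] \<open>e > 0\<close> by linarith
  have rz: "norm (?r ?z) \<le> e * (s * ?N)"
    using approx[of ?z] nz s mult_left_mono[OF nz, of e] \<open>e > 0\<close> by linarith
  have "F ?y - F ?z = s *\<^sub>R H v + (?r ?y - ?r ?z)"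
    using \<open>linear H\<close> by (simp add: linear_add linear_scale linear_diff algebra_simps)
  then have eq: "u \<bullet> F ?y - u \<bullet> F ?z = s * (u \<bullet> H v) + u \<bullet> (?r ?y - ?r ?z)"
    unfolding inner_diff_right[symmetric] by (simp only: inner_add_right inner_scaleR_right)
  have "\<bar>u \<bullet> (?r ?y - ?r ?z)\<bar> \<le> norm u * norm (?r ?y - ?r ?z)"
    by (rule Cauchy_Schwarz_ineq2)
  also have "\<dots> \<le> ?N * (2 * e * (s * ?N))"
    using norm_triangle_ineq4[of "?r ?y" "?r ?z"] ry rz
    by (intro mult_mono) auto
  finally have "s * \<bar>u \<bullet> (?r ?y - ?r ?z)\<bar> \<le> s * (?N * (2 * e * (s * ?N)))"
    using s by (simp add: mult_left_mono)
  moreover have "?\<phi> s - ?\<phi> 0 - s\<^sup>2 * (u \<bullet> H v) = s * (u \<bullet> (?r ?y - ?r ?z))"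
    unfolding mvt eq by (simp add: power2_eq_square algebra_simps)
  ultimately have "\<bar>?\<phi> s - ?\<phi> 0 - s\<^sup>2 * (u \<bullet> H v)\<bar> \<le> s * (?N * (2 * e * (s * ?N)))"
    using s by (simp add: abs_mult)
  then show ?thesis
    by (simp add: power2_eq_square algebra_simps)
qed

text \<open>The second difference is symmetric in \<open>u\<close> and \<open>v\<close>, and divided by \<open>s\<^sup>2\<close> it tends to \<open>u \<bullet> H v\<close>.\<close>

lemma derivative_of_gradient_symmetric:
  fixes f :: "'a::real_inner \<Rightarrow> real"
  assumes grad: "\<And>x. GDERIV f x :> F x" and H: "(F has_derivative H) (at x)"
  shows "u \<bullet> H v = H u \<bullet> v"
proof (rule ccontr)
  assume "u \<bullet> H v \<noteq> H u \<bullet> v"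
  let ?D = "\<bar>u \<bullet> H v - v \<bullet> H u\<bar>"
  define N where "N = norm u + norm v"
  have D: "?D > 0"
    using \<open>u \<bullet> H v \<noteq> H u \<bullet> v\<close> by (simp add: inner_commute)
  have N: "N > 0"
    using D by (cases "u = 0") (auto simp: N_def intro: add_pos_nonneg)
  \<comment> \<open>Two estimates with error \<open>2 e N\<^sup>2\<close> each then add up to half of the discrepancy.\<close>
  define e where "e = ?D / (8 * N\<^sup>2)"
  have "e > 0"
    using D N by (simp add: e_def)
  then obtain \<delta> where "\<delta> > 0"
    and approx: "\<And>y. norm (y - x) < \<delta> \<Longrightarrow> norm (F y - F x - H (y - x)) \<le> e * norm (y - x)"
    using H unfolding has_derivative_at_alt by blast
  define s where "s = \<delta> / (2 * N)"
  have "s > 0" "s * N < \<delta>"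
    using \<open>\<delta> > 0\<close> N by (simp_all add: s_def)
  then have s: "s > 0" "s * (norm u + norm v) < \<delta>"
    by (simp_all add: N_def)
  have lin: "linear H"
    using H by (rule has_derivative_linear)
  let ?\<Delta> = "f (x + s *\<^sub>R u + s *\<^sub>R v) - f (x + s *\<^sub>R u) - f (x + s *\<^sub>R v) + f x"
  have 1: "\<bar>?\<Delta> - s\<^sup>2 * (u \<bullet> H v)\<bar> \<le> s\<^sup>2 * (2 * e * N\<^sup>2)"
    unfolding N_def by (rule second_difference_estimate[OF grad lin approx s \<open>e > 0\<close>])
  have s': "s * (norm v + norm u) < \<delta>"
    using s by (simp add: add.commute)
  have 2: "\<bar>?\<Delta> - s\<^sup>2 * (v \<bullet> H u)\<bar> \<le> s\<^sup>2 * (2 * e * N\<^sup>2)"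
    using second_difference_estimate[OF grad lin approx s(1) s' \<open>e > 0\<close>]
    unfolding N_def by (simp add: algebra_simps)
  have "\<bar>s\<^sup>2 * (u \<bullet> H v) - s\<^sup>2 * (v \<bullet> H u)\<bar> \<le> 2 * (s\<^sup>2 * (2 * e * N\<^sup>2))"
    using 1 2 by linarith
  also have "\<dots> = s\<^sup>2 * (?D / 2)"
    using N by (simp add: e_def)
  finally have "s\<^sup>2 * ?D \<le> s\<^sup>2 * (?D / 2)"
    by (simp only: right_diff_distrib[symmetric] abs_mult abs_power2)
  then show False
    using D s by simp
qed

text \<open>The direction \<open>u\<close> enters only through short multiples \<open>s u\<close>, for which \<open>H (s u)\<close> is an increment of
\<open>F\<close> up to an error of lower order.\<close>

lemma derivative_norm_le_lipschitz:
  fixes F :: "'a::real_normed_vector \<Rightarrow> 'b::real_normed_vector"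
  assumes "(F has_derivative H) (at x)" and lip: "L-lipschitz_on UNIV F"
  shows "norm (H u) \<le> L * norm u"
proof (cases "u = 0")
  case True
  then show ?thesis
    using assms(1) has_derivative_linear linear_0 by fastforce
next
  case False
  have lin: "linear H"
    using assms(1) by (rule has_derivative_linear)
  have "norm (H u) \<le> L * norm u + e" if "e > 0" for e
  proof -
    define e' where "e' = e / norm u"
    have "e' > 0"
      using False that by (simp add: e'_def)
    then obtain d where "d > 0"
      and d: "\<And>y. norm (y - x) < d \<Longrightarrow> norm (F y - F x - H (y - x)) \<le> e' * norm (y - x)"
      using assms(1) unfolding has_derivative_at_alt by blast
    define s where "s = d / (2 * norm u)"
    have s: "s > 0" "s * norm u < d"
      using \<open>d > 0\<close> False by (auto simp: s_def)
    have "norm (F (x + s *\<^sub>R u) - F x - s *\<^sub>R H u) \<le> e' * (s * norm u)"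
      using d[of "x + s *\<^sub>R u"] s lin by (simp add: linear_scale)
    moreover have "norm (F (x + s *\<^sub>R u) - F x) \<le> L * (s * norm u)"
      using lipschitz_on_normD[OF lip, of "x + s *\<^sub>R u" x] s by simp
    ultimately have "norm (s *\<^sub>R H u) \<le> L * (s * norm u) + e' * (s * norm u)"
      using norm_triangle_ineq4[of "F (x + s *\<^sub>R u) - F x" "F (x + s *\<^sub>R u) - F x - s *\<^sub>R H u"]
      by simp
    then have "s * norm (H u) \<le> s * (L * norm u + e)"
      using s False by (simp add: e'_def algebra_simps)
    then show ?thesis
      using s by simp
  qed
  then show ?thesis
    by (rule field_le_epsilon)
qed

section \<open>The proximal step as an implicit gradient step\<close>

text \<open>The bound compares \<open>f\<close> on the segment with a concave parabola; the derivative of the gap \<open>\<psi>\<close> is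
nonnegative because the gradient changes by at most \<open>L t \<bar>u\<bar>\<close>.\<close>

lemma descent_lower_bound:
  fixes f :: "'a::real_inner \<Rightarrow> real"
  assumes grad: "\<And>x. GDERIV f x :> F x" and lip: "L-lipschitz_on UNIV F"
  shows "f x + u \<bullet> F x - L / 2 * (norm u)\<^sup>2 \<le> f (x + u)"
proof -
  define \<psi> where "\<psi> t = f (x + t *\<^sub>R u) - t * (u \<bullet> F x) + L / 2 * t\<^sup>2 * (norm u)\<^sup>2" for t
  have "\<psi> 0 \<le> \<psi> 1"
  proof (rule DERIV_nonneg_imp_nondecreasing[of 0 1 \<psi>])
    fix t :: real assume t: "0 \<le> t" "t \<le> 1"
    let ?D = "u \<bullet> F (x + t *\<^sub>R u) - u \<bullet> F x + L * t * (norm u)\<^sup>2"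
    have "(\<psi> has_real_derivative ?D) (at t)"
      unfolding \<psi>_def by (auto intro!: derivative_eq_intros GDERIV_along_line grad)
    moreover have "\<bar>u \<bullet> (F (x + t *\<^sub>R u) - F x)\<bar> \<le> norm u * (L * (t * norm u))"
      using Cauchy_Schwarz_ineq2[of u "F (x + t *\<^sub>R u) - F x"]
        lipschitz_on_normD[OF lip, of "x + t *\<^sub>R u" x] t
      by (smt (verit) UNIV_I add_diff_cancel_left' mult_left_mono norm_ge_zero norm_scaleR abs_of_nonneg)
    then have "0 \<le> ?D"
      by (simp add: inner_diff_right power2_eq_square algebra_simps)
    ultimately show "\<exists>y. (\<psi> has_real_derivative y) (at t) \<and> 0 \<le> y"
      by blast
  qed simp
  then show ?thesis
    by (simp add: \<psi>_def)
qed

text \<open>By the quadratic lower bound the objective is at least \<open>f x\<close>, its value at \<open>x\<close>, outside a ball around \<open>x\<close>: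
the linear term is dominated once \<open>\<bar>y - x\<bar> \<ge> \<bar>F x\<bar> / c\<close>. So a minimum over that ball is global.\<close>

lemma proximal_objective_attains_min:
  fixes f :: "'a::euclidean_space \<Rightarrow> real"
  assumes grad: "\<And>x. GDERIV f x :> F x" and lip: "L-lipschitz_on UNIV F"
    and a: "0 < a" "a * L < 1"
  shows "\<exists>z. \<forall>y. f z + 1 / (2 * a) * (norm (z - x))\<^sup>2 \<le> f y + 1 / (2 * a) * (norm (y - x))\<^sup>2"
proof -
  let ?h = "\<lambda>z. f z + 1 / (2 * a) * (norm (z - x))\<^sup>2"
  define c where "c = 1 / (2 * a) - L / 2"
  have "c > 0"
    using a by (simp add: c_def field_simps)
  define R where "R = norm (F x) / c"
  have "R \<ge> 0"
    using \<open>c > 0\<close> by (simp add: R_def)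
  have "continuous_on (cball x R) f"
    using grad by (meson continuous_at_imp_continuous_on gderiv_def has_derivative_continuous)
  then have "continuous_on (cball x R) ?h"
    by (intro continuous_intros)
  then obtain z where z: "z \<in> cball x R" "\<And>y. y \<in> cball x R \<Longrightarrow> ?h z \<le> ?h y"
    using continuous_attains_inf[of "cball x R" ?h] \<open>R \<ge> 0\<close> by auto
  have "?h z \<le> ?h y" for y
  proof (cases "y \<in> cball x R")
    case False
    let ?u = "y - x"
    have "norm (F x) \<le> c * norm ?u"
      using False \<open>c > 0\<close> by (simp add: R_def dist_norm norm_minus_commute field_simps)
    then have "norm ?u * norm (F x) \<le> norm ?u * (c * norm ?u)"
      by (simp add: mult_left_mono)
    then have "norm ?u * norm (F x) \<le> c * (norm ?u)\<^sup>2"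
      by (simp add: power2_eq_square mult_ac)
    then have "- (?u \<bullet> F x) \<le> c * (norm ?u)\<^sup>2"
      using Cauchy_Schwarz_ineq2[of ?u "F x"] by linarith
    moreover have "f x + ?u \<bullet> F x - L / 2 * (norm ?u)\<^sup>2 \<le> f y"
      using descent_lower_bound[OF grad lip, of x ?u] by simp
    ultimately have "f x \<le> ?h y"
      unfolding c_def left_diff_distrib by linarith
    moreover have "?h z \<le> f x"
      using z(2)[of x] \<open>R \<ge> 0\<close> by simp
    ultimately show ?thesis
      by linarith
  qed (use z in auto)
  then show ?thesis
    by blast
qed

text \<open>This is the first-order condition at the minimizer. It expresses the proximal step as a backward Euler step
of the gradient flow and supplies the explicit left inverse on which everything below relies.\<close>

lemma prox_step_implicit:
  fixes f :: "'a::euclidean_space \<Rightarrow> real"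
  assumes grad: "\<And>x. GDERIV f x :> F x" and lip: "L-lipschitz_on UNIV F"
    and a: "0 < a" "a * L < 1"
  shows "prox_step f a x + a *\<^sub>R F (prox_step f a x) = x"
proof -
  let ?h = "\<lambda>z. f z + 1 / (2 * a) * (norm (z - x))\<^sup>2"
  let ?z = "prox_step f a x"
  have "\<exists>z. is_arg_min ?h (\<lambda>y. y \<in> UNIV) z"
    using proximal_objective_attains_min[OF assms, of x] by (auto simp: is_arg_min_linorder)
  then have "is_arg_min ?h (\<lambda>y. y \<in> UNIV) ?z"
    unfolding prox_step_def arg_min_on_def arg_min_def by (rule someI_ex)
  then have min: "?h ?z \<le> ?h y" for y
    by (simp add: is_arg_min_linorder)
  have 1: "((\<lambda>z. (z - x) \<bullet> (z - x)) has_derivative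
      (\<lambda>u. (?z - x) \<bullet> u + u \<bullet> (?z - x))) (at ?z)"
    by (auto intro!: derivative_eq_intros)
  have "((\<lambda>z. f z + 1 / (2 * a) * ((z - x) \<bullet> (z - x))) has_derivative
      (\<lambda>u. u \<bullet> F ?z + 1 / (2 * a) * ((?z - x) \<bullet> u + u \<bullet> (?z - x)))) (at ?z)"
    by (intro has_derivative_add has_derivative_mult_right 1 grad[unfolded gderiv_def])
  then have "(?h has_derivative (\<lambda>u. u \<bullet> F ?z + 1 / (2 * a) * ((?z - x) \<bullet> u + u \<bullet> (?z - x)))) (at ?z)"
    by (simp add: power2_norm_eq_inner)
  then have "(\<lambda>u. u \<bullet> F ?z + 1 / (2 * a) * ((?z - x) \<bullet> u + u \<bullet> (?z - x))) = (\<lambda>u. 0)"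
    by (rule has_derivative_local_min) (use min in auto)
  then have eq: "u \<bullet> F ?z + 1 / (2 * a) * ((?z - x) \<bullet> u + u \<bullet> (?z - x)) = 0" for u
    by (rule fun_cong)
  have "u \<bullet> (?z + a *\<^sub>R F ?z - x) = a * (u \<bullet> F ?z + 1 / (2 * a) * ((?z - x) \<bullet> u + u \<bullet> (?z - x)))" for u
    using a by (simp add: inner_commute field_simps inner_add_right inner_diff_right)
  then have "u \<bullet> (?z + a *\<^sub>R F ?z - x) = 0" for u
    by (simp only: eq mult_zero_right)
  then show ?thesis
    by (metis eq_iff_diff_eq_0 inner_eq_zero_iff)
qed

section \<open>Self-adjoint operators\<close>

text \<open>Eigenvectors for distinct eigenvalues are orthogonal, and a pairwise orthogonal set is finite.\<close>

lemma finite_eigenvalues_self_adjoint: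
  fixes H :: "'a::euclidean_space \<Rightarrow> 'a"
  assumes sym: "\<And>u v. u \<bullet> H v = H u \<bullet> v"
  shows "finite {c. \<exists>v. v \<noteq> 0 \<and> H v = c *\<^sub>R v}"
proof -
  let ?E = "{c. \<exists>v. v \<noteq> 0 \<and> H v = c *\<^sub>R v}"
  obtain w where w: "\<And>c. c \<in> ?E \<Longrightarrow> w c \<noteq> 0 \<and> H (w c) = c *\<^sub>R w c"
    using bchoice[of ?E "\<lambda>c v. v \<noteq> 0 \<and> H v = c *\<^sub>R v"] by auto
  have orth: "w c \<bullet> w d = 0" if "c \<in> ?E" "d \<in> ?E" "c \<noteq> d" for c d
    using sym[of "w c" "w d"] w[OF that(1)] w[OF that(2)] that(3) by simp
  have "inj_on w ?E"
  proof (rule inj_onI, rule ccontr)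
    fix c d assume "c \<in> ?E" "d \<in> ?E" "w c = w d" "c \<noteq> d"
    then show False
      using orth[of c d] w[of d] by simp
  qed
  moreover have "finite (w ` ?E)"
    by (rule pairwise_orthogonal_imp_finite) (auto simp: pairwise_def orthogonal_def intro: orth)
  ultimately show ?thesis
    by (rule finite_imageD[rotated])
qed

text \<open>Here \<open>A\<close> stands for \<open>H - \<mu> I\<close>, so \<open>d\<close> is the state before an implicit step of length \<open>a\<close> that ends
in \<open>u\<close>, with linearization error \<open>e\<close>. With \<open>b = 1 + a \<mu>\<close> and \<open>p = b u + a A u\<close>, the value of the form
at \<open>p\<close> is \<open>b\<^sup>2 Q u + 2 a b \<bar>A u\<bar>\<^sup>2 + a\<^sup>2 Q (A u)\<close>. The lower bound on \<open>Q\<close> controls the last term,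
which leaves at least \<open>2 a (1 - \<sigma> L) \<bar>A u\<bar>\<^sup>2\<close> beyond \<open>b\<^sup>2 Q u\<close>. The terms with \<open>e\<close> carry a factor
\<open>a \<epsilon>\<close>, so that the surplus covers them uniformly for all step sizes up to \<open>\<sigma>\<close>, however small.\<close>

lemma implicit_step_expands_form:
  fixes A :: "'a::real_inner \<Rightarrow> 'a"
  assumes lin: "linear A" and sym: "\<And>u v. u \<bullet> A v = A u \<bullet> v"
    and lower: "\<And>u. - (L + \<mu>) * (norm u)\<^sup>2 \<le> u \<bullet> A u"
    and upper: "\<And>u. norm (A u) \<le> B * norm u" and B: "0 \<le> B"
    and inj: "\<And>u. \<delta> * norm u \<le> norm (A u)" and \<delta>: "0 \<le> \<delta>"
    and \<mu>: "- L \<le> \<mu>" "\<mu> \<le> 0"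
    and a: "0 < a" "a \<le> \<sigma>" "\<sigma> * L < 1" and L: "0 \<le> L"
    and e: "norm e \<le> \<epsilon> * norm u" and \<epsilon>: "0 \<le> \<epsilon>" "\<epsilon> \<le> 1"
    and small: "\<epsilon> * (2 * B * (1 + \<sigma> * B) + \<sigma> * B) \<le> 2 * (1 - \<sigma> * L) * \<delta>\<^sup>2"
    and d: "d = u + a *\<^sub>R (A u + \<mu> *\<^sub>R u + e)"
  shows "(1 + a * \<mu>)\<^sup>2 * (u \<bullet> A u) \<le> d \<bullet> A d"
proof -
  define b where "b = 1 + a * \<mu>"
  define p where "p = b *\<^sub>R u + a *\<^sub>R A u"
  have aL: "a * L \<le> \<sigma> * L"
    using a L by (simp add: mult_right_mono)
  have a\<mu>: "- (a * L) \<le> a * \<mu>" "a * \<mu> \<le> 0"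
    using a \<mu> mult_left_mono[of "-L" \<mu> a] by (auto simp: mult_nonneg_nonpos)
  have b: "0 \<le> b" "b \<le> 1"
    using a\<mu> aL a by (auto simp: b_def)
  have dp: "d = p + a *\<^sub>R e"
    by (simp add: d p_def b_def algebra_simps)
  note lins = linear_add[OF lin] linear_scale[OF lin]

  have "p \<bullet> A p = b\<^sup>2 * (u \<bullet> A u) + 2 * a * b * (norm (A u))\<^sup>2 + a\<^sup>2 * (A u \<bullet> A (A u))"
    using sym[of u "A u"]
    by (simp add: p_def lins inner_add_left inner_add_right power2_norm_eq_inner)
       (simp add: power2_eq_square algebra_simps)
  moreover have "a\<^sup>2 * (- (L + \<mu>) * (norm (A u))\<^sup>2) \<le> a\<^sup>2 * (A u \<bullet> A (A u))"
    using lower by (intro mult_left_mono) auto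
  moreover have "2 * a * b * (norm (A u))\<^sup>2 + a\<^sup>2 * (- (L + \<mu>) * (norm (A u))\<^sup>2)
      = a * (2 + a * \<mu> - a * L) * (norm (A u))\<^sup>2"
    by (simp add: b_def power2_eq_square algebra_simps)
  moreover have "a * (2 * (1 - \<sigma> * L)) * (\<delta> * norm u)\<^sup>2 \<le> a * (2 + a * \<mu> - a * L) * (norm (A u))\<^sup>2"
    using a a\<mu> aL inj \<delta> by (intro mult_mono power_mono) auto
  ultimately have main: "b\<^sup>2 * (u \<bullet> A u) + a * (2 * (1 - \<sigma> * L) * \<delta>\<^sup>2) * (norm u)\<^sup>2 \<le> p \<bullet> A p"
    by (simp add: power_mult_distrib algebra_simps)

  have "norm p \<le> b * norm u + a * norm (A u)"
    unfolding p_def using norm_triangle_ineq[of "b *\<^sub>R u" "a *\<^sub>R A u"] a b by simp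
  also have "\<dots> \<le> 1 * norm u + \<sigma> * (B * norm u)"
    using a b upper by (intro add_mono mult_mono) auto
  finally have "norm p \<le> (1 + \<sigma> * B) * norm u"
    by (simp add: algebra_simps)
  then have "norm (A p) \<le> B * ((1 + \<sigma> * B) * norm u)"
    using upper[of p] B by (meson mult_left_mono order_trans)
  then have "norm e * norm (A p) \<le> \<epsilon> * norm u * (B * ((1 + \<sigma> * B) * norm u))"
    using e by (intro mult_mono) (auto intro: order_trans[OF norm_ge_zero])
  then have 1: "\<bar>e \<bullet> A p\<bar> \<le> \<epsilon> * (B * (1 + \<sigma> * B)) * (norm u)\<^sup>2"
    using Cauchy_Schwarz_ineq2[of e "A p"] by (simp add: power2_eq_square mult_ac)
  have "\<epsilon> * norm u \<le> 1 * norm u"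
    using \<epsilon> by (intro mult_right_mono) auto
  then have "norm (A e) \<le> B * (1 * norm u)"
    using upper[of e] B e by (meson mult_left_mono order_trans)
  then have "norm e * norm (A e) \<le> \<epsilon> * norm u * (B * (1 * norm u))"
    using e by (intro mult_mono) (auto intro: order_trans[OF norm_ge_zero])
  then have e2: "\<bar>e \<bullet> A e\<bar> \<le> \<epsilon> * B * (norm u)\<^sup>2"
    using Cauchy_Schwarz_ineq2[of e "A e"] by (simp add: power2_eq_square mult_ac)
  have 2: "a * \<bar>e \<bullet> A e\<bar> \<le> \<sigma> * (\<epsilon> * B * (norm u)\<^sup>2)"
    using a e2 by (intro mult_mono) auto
  have "- (2 * (e \<bullet> A p) + a * (e \<bullet> A e)) \<le> 2 * \<bar>e \<bullet> A p\<bar> + a * \<bar>e \<bullet> A e\<bar>"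
    using a mult_left_mono[of "- (e \<bullet> A e)" "\<bar>e \<bullet> A e\<bar>" a] by linarith
  also have "\<dots> \<le> 2 * (\<epsilon> * (B * (1 + \<sigma> * B)) * (norm u)\<^sup>2) + \<sigma> * (\<epsilon> * B * (norm u)\<^sup>2)"
    using 1 2 by linarith
  also have "\<dots> = \<epsilon> * (2 * B * (1 + \<sigma> * B) + \<sigma> * B) * (norm u)\<^sup>2"
    by (simp add: algebra_simps)
  also have "\<dots> \<le> 2 * (1 - \<sigma> * L) * \<delta>\<^sup>2 * (norm u)\<^sup>2"
    using small by (rule mult_right_mono) simp
  finally have "a * - (2 * (e \<bullet> A p) + a * (e \<bullet> A e)) \<le> a * (2 * (1 - \<sigma> * L) * \<delta>\<^sup>2 * (norm u)\<^sup>2)"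
    using a by (intro mult_left_mono) auto
  moreover have "d \<bullet> A d = p \<bullet> A p + a * (2 * (e \<bullet> A p) + a * (e \<bullet> A e))"
    using sym[of p e]
    by (simp add: dp lins inner_add_left inner_add_right inner_commute algebra_simps)
  ultimately show ?thesis
    using main unfolding b_def mult_minus_right by (simp only: mult.assoc)
qed

section \<open>Trajectories that stay near a saddle\<close>

text \<open>A positive start value would make \<open>q\<close> increase, and \<open>(1 - t)\<^sup>2 \<le> 1 - t\<close> then gives increments of at
least \<open>a\<^sub>k c q\<^sub>K\<close>, whose sum diverges.\<close>

lemma bounded_expanding_sequence_nonpos:
  fixes q a :: "nat \<Rightarrow> real"
  assumes div: "filterlim (\<lambda>n. \<Sum>k<n. a k) at_top sequentially"
    and c: "0 < c" and a: "\<And>k. 0 < a k" "\<And>k. a k * c \<le> 1"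
    and step: "\<And>k. k \<ge> K \<Longrightarrow> q k \<le> (1 - a k * c)\<^sup>2 * q (Suc k)"
    and bound: "\<And>k. k \<ge> K \<Longrightarrow> q k \<le> C"
  shows "q K \<le> 0"
proof (rule ccontr)
  assume "\<not> q K \<le> 0"
  then have pos: "q K > 0"
    by simp
  let ?S = "\<lambda>n. \<Sum>k<n. a k"
  have grow: "q K * (1 + c * (?S n - ?S K)) \<le> q n \<and> q K \<le> q n" if "n \<ge> K" for n
    using that
  proof (induction n rule: dec_induct)
    case (step n)
    have "0 < (1 - a n * c)\<^sup>2 * q (Suc n)"
      using assms(5)[of n] step pos by linarith
    then have pos': "0 < q (Suc n)"
      by (simp add: zero_less_mult_iff)
    have "(1 - a n * c)\<^sup>2 \<le> 1 - a n * c"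
      using a(1)[of n] a(2)[of n] c by (simp add: power2_eq_square mult_left_le)
    then have "q n \<le> (1 - a n * c) * q (Suc n)"
      using assms(5)[of n] step pos' by (meson less_imp_le mult_right_mono order_trans)
    then have le: "q n + a n * c * q (Suc n) \<le> q (Suc n)"
      by (simp add: algebra_simps)
    have "0 \<le> a n * c * q (Suc n)"
      using a(1)[of n] c pos' by simp
    then have "q K \<le> q (Suc n)"
      using le step by linarith
    moreover from this have "a n * c * q K \<le> a n * c * q (Suc n)"
      using a(1)[of n] c by (intro mult_left_mono) auto
    then have "q K * (1 + c * (?S (Suc n) - ?S K)) \<le> q (Suc n)"
      using le step by (simp add: algebra_simps)
    ultimately show ?case
      by blast
  qed simp
  have "eventually (\<lambda>n. ?S n \<ge> ?S K + (C / q K) / c) sequentially"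
    using div by (auto simp: filterlim_at_top)
  then obtain n where n: "n \<ge> K" "?S n \<ge> ?S K + (C / q K) / c"
    unfolding eventually_sequentially by (meson nle_le)
  have "(C / q K) / c \<le> ?S n - ?S K"
    using n(2) by linarith
  then have "C / q K \<le> c * (?S n - ?S K)"
    using c by (simp only: pos_divide_le_eq mult.commute)
  then have "C \<le> q K * (c * (?S n - ?S K))"
    using pos by (simp add: field_simps)
  then have "C + q K \<le> q n"
    using grow[OF n(1)] by (simp add: algebra_simps)
  then show False
    using bound[OF n(1)] pos by linarith
qed

text \<open>The mean value inequality for \<open>y \<mapsto> F y - D x y\<close>, whose derivative \<open>D w - D x\<close> is small near \<open>x\<close>.\<close>

lemma derivative_error_small_near:
  fixes F :: "real ^ 'n \<Rightarrow> real ^ 'n"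
  assumes der: "\<And>x. (F has_derivative (*v) (D x)) (at x)"
    and cont: "continuous_on UNIV D" and "\<epsilon> > 0"
  obtains r where "r > 0"
    "\<And>y z. y \<in> ball x r \<Longrightarrow> z \<in> ball x r \<Longrightarrow> norm (F y - F z - D x *v (y - z)) \<le> \<epsilon> * norm (y - z)"
proof -
  let ?n = "real CARD('n) * real CARD('n)"
  have "\<epsilon> / ?n > 0"
    using \<open>\<epsilon> > 0\<close> by simp
  then obtain r where "r > 0" and r: "\<And>y. dist y x < r \<Longrightarrow> dist (D y) (D x) < \<epsilon> / ?n"
    using cont unfolding continuous_on_iff by (metis UNIV_I)
  have on: "onorm ((*v) (D y - D x)) \<le> \<epsilon>" if "y \<in> ball x r" for y
  proof -
    have "\<bar>(D y - D x) $ i $ j\<bar> \<le> \<epsilon> / ?n" for i j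
      using r[of y] that component_le_norm_cart[of "(D y - D x) $ i" j]
        Finite_Cartesian_Product.norm_nth_le[of "D y - D x" i]
      by (simp add: dist_norm norm_minus_commute mem_ball)
    then have "onorm ((*v) (D y - D x)) \<le> ?n * (\<epsilon> / ?n)"
      by (rule onorm_le_matrix_component)
    then show ?thesis
      by simp
  qed
  have "norm ((F y - D x *v y) - (F z - D x *v z)) \<le> \<epsilon> * norm (y - z)"
    if "y \<in> ball x r" "z \<in> ball x r" for y z
  proof (rule differentiable_bound[OF convex_ball _ on that])
    fix w
    have "((\<lambda>y. F y - D x *v y) has_derivative (\<lambda>h. D w *v h - D x *v h)) (at w)"
      by (intro has_derivative_diff der bounded_linear_imp_has_derivative matrix_vector_mul_bounded_linear)
    moreover have "(*v) (D w - D x) = (\<lambda>h. D w *v h - D x *v h)"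
      by (rule ext) (rule matrix_vector_mult_diff_rdistrib)
    ultimately show "((\<lambda>y. F y - D x *v y) has_derivative (*v) (D w - D x)) (at w within ball x r)"
      by (simp only: has_derivative_at_withinI)
  qed
  then show ?thesis
    using that[OF \<open>r > 0\<close>] by (simp add: matrix_vector_mult_diff_distrib algebra_simps)
qed

section \<open>Null sets\<close>

text \<open>Let \<open>P\<close> be the orthogonal projection along \<open>v\<close>. The splitting of \<open>x\<close> into \<open>P x\<close> and a multiple of
\<open>v\<close> is orthogonal also for the form \<open>x \<bullet> A x\<close>, because \<open>v\<close> is an eigenvector. A nonnegative value
therefore bounds the \<open>v\<close>-component by \<open>P x\<close>. Applied to differences this says that \<open>P\<close> is injective
on \<open>W\<close> with Lipschitz inverse, and \<open>P\<close> maps \<open>W\<close> into a hyperplane.\<close>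

lemma negligible_outside_cone:
  fixes A :: "'a::euclidean_space \<Rightarrow> 'a"
  assumes lin: "linear A" and sym: "\<And>u v. u \<bullet> A v = A u \<bullet> v"
    and eig: "A v = \<kappa> *\<^sub>R v" "v \<noteq> 0" "\<kappa> < 0"
    and W: "\<And>x y. x \<in> W \<Longrightarrow> y \<in> W \<Longrightarrow> 0 \<le> (x - y) \<bullet> A (x - y)"
  shows "negligible W"
proof -
  define P where "P x = x - (x \<bullet> v / (v \<bullet> v)) *\<^sub>R v" for x
  have vP: "v \<bullet> P x = 0" for x
    using eig by (simp add: P_def inner_diff_right inner_commute)
  have linP: "P x - P y = P (x - y)" for x y
    by (simp add: P_def inner_diff_left diff_divide_distrib algebra_simps)
  obtain B where "B > 0" and B: "\<And>x. norm (A x) \<le> B * norm x"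
    using linear_bounded_pos[OF lin] by blast
  define C where "C = 1 + sqrt (B / - \<kappa>)"
  have "norm x \<le> C * norm (P x)" if "0 \<le> x \<bullet> A x" for x
  proof -
    define t where "t = x \<bullet> v / (v \<bullet> v)"
    have x: "x = P x + t *\<^sub>R v"
      by (simp add: P_def t_def)
    have "P x \<bullet> A v = 0" "v \<bullet> A (P x) = 0"
      using vP sym[of v "P x"] by (simp_all add: eig inner_commute)
    then have "(P x + t *\<^sub>R v) \<bullet> A (P x + t *\<^sub>R v) = P x \<bullet> A (P x) + t\<^sup>2 * (v \<bullet> A v)"
      by (simp add: linear_add[OF lin] linear_scale[OF lin] inner_add_left inner_add_right power2_eq_square)
    then have "x \<bullet> A x = P x \<bullet> A (P x) + \<kappa> * (norm (t *\<^sub>R v))\<^sup>2"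
      using x by (simp add: eig power_mult_distrib power2_norm_eq_inner)
    moreover have "P x \<bullet> A (P x) \<le> norm (P x) * (B * norm (P x))"
      using norm_cauchy_schwarz[of "P x" "A (P x)"] B[of "P x"]
      by (meson mult_left_mono norm_ge_zero order_trans)
    ultimately have "- \<kappa> * (norm (t *\<^sub>R v))\<^sup>2 \<le> B * (norm (P x))\<^sup>2"
      using that by (simp add: power2_eq_square mult.left_commute)
    then have "(norm (t *\<^sub>R v))\<^sup>2 \<le> B / - \<kappa> * (norm (P x))\<^sup>2"
      using eig by (simp add: field_simps)
    then have "norm (t *\<^sub>R v) \<le> sqrt (B / - \<kappa> * (norm (P x))\<^sup>2)"
      by (rule real_le_rsqrt)
    then have "norm (t *\<^sub>R v) \<le> sqrt (B / - \<kappa>) * norm (P x)"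
      by (simp only: real_sqrt_mult real_sqrt_abs abs_norm_cancel)
    then show ?thesis
      using norm_triangle_ineq[of "P x" "t *\<^sub>R v"] x by (simp add: C_def algebra_simps)
  qed
  then have lip: "norm (x - y) \<le> C * norm (P x - P y)" if "x \<in> W" "y \<in> W" for x y
    using W[OF that] linP by simp
  have inj: "inj_on P W"
    by (rule inj_onI) (use lip in fastforce)
  have "negligible {x. v \<bullet> x = 0}"
    using eig by (simp add: negligible_hyperplane)
  then have neg: "negligible (P ` W)"
    by (rule negligible_subset) (auto simp: vP)
  have "negligible (inv_into W P ` (P ` W))"
  proof (rule negligible_locally_Lipschitz_image[OF order_refl neg])
    fix p assume "p \<in> P ` W"
    then show "\<exists>T B. open T \<and> p \<in> T \<and>
        (\<forall>y\<in>P ` W \<inter> T. norm (inv_into W P y - inv_into W P p) \<le> B * norm (y - p))"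
      using lip inj by (intro exI[of _ UNIV] exI[of _ C]) auto
  qed
  then show ?thesis
    using inj by (simp add: inv_into_image_cancel)
qed

text \<open>The preimage of \<open>N\<close> under \<open>g k\<close> is contained in the Lipschitz image of \<open>N\<close> under \<open>G k\<close>.\<close>

lemma negligible_trajectory_preimage:
  fixes g G :: "nat \<Rightarrow> 'a::euclidean_space \<Rightarrow> 'a"
  assumes left_inverse: "\<And>k x. G k (g k x) = x"
    and lip: "\<And>k. (C k)-lipschitz_on UNIV (G k)" and "negligible N"
  shows "negligible {x. trajectory g x K \<in> N}"
  using \<open>negligible N\<close>
proof (induction K arbitrary: N)
  case (Suc K)
  have "negligible (G K ` N)"
    using lipschitz_on_normD[OF lip[of K]]
    by (intro negligible_locally_Lipschitz_image[OF order_refl Suc.prems]) blast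
  then have "negligible {x. trajectory g x K \<in> G K ` N}"
    by (rule Suc.IH)
  then show ?case
    by (rule negligible_subset) (auto intro: rev_image_eqI simp: left_inverse)
qed simp

section \<open>Avoidance of strict saddles\<close>

text \<open>Two trajectories that remain near \<open>x\<close> give a bounded sequence of differences, to which the expansion of the
form applies in every step. The radius is independent of the time \<open>K\<close>, as it depends on the step sizes only through their common bound
\<open>\<sigma>\<close>.\<close>

lemma trajectories_near_strict_saddle_negligible:
  fixes f :: "real ^ 'n \<Rightarrow> real"
  assumes "C2 f" and L: "L > 0" and lip: "L-lipschitz_on UNIV (grad f)"
    and \<alpha>: "\<And>k. 0 < \<alpha> k" "\<And>k. \<alpha> k \<le> \<sigma>" and \<sigma>: "\<sigma> * L < 1"
    and div: "filterlim (\<lambda>n. \<Sum>k<n. \<alpha> k) at_top sequentially"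
    and implicit: "\<And>k x. g k x + \<alpha> k *\<^sub>R grad f (g k x) = x"
    and saddle: "strict_saddle f x"
  obtains r where "r > 0"
    "\<And>K. negligible ((\<lambda>x0. trajectory g x0 K) ` {x0. \<forall>k\<ge>K. trajectory g x0 k \<in> ball x r})"
proof -
  let ?F = "grad f" and ?H = "(*v) (hessian f x)"
  have grad: "GDERIV f y :> ?F y" for y
    using \<open>C2 f\<close> by (intro GDERIV_grad) (simp add: C2_def)
  have der: "(?F has_derivative (*v) (hessian f y)) (at y)" for y
    using \<open>C2 f\<close> by (rule hessian_has_derivative)
  have symH: "u \<bullet> ?H v = ?H u \<bullet> v" for u v
    by (rule derivative_of_gradient_symmetric[OF grad der])
  have boundH: "norm (?H u) \<le> L * norm u" for u
    by (rule derivative_norm_le_lipschitz[OF der lip])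
  have "\<sigma> > 0"
    using \<alpha>[of 0] by linarith

  obtain \<nu> v where "\<nu> < 0" and v: "v \<noteq> 0" "?H v = \<nu> *\<^sub>R v"
    using saddle by (auto simp: strict_saddle_def eigenvalue_def)
  have "\<bar>\<nu>\<bar> * norm v \<le> L * norm v"
    using boundH[of v] v by simp
  then have "\<bar>\<nu>\<bar> \<le> L"
    by (rule mult_right_le_imp_le) (simp add: v)
  then have "- L \<le> \<nu>"
    by linarith
  \<comment> \<open>A threshold \<open>\<mu>\<close> that separates \<open>v\<close> from the nonnegative directions of \<open>H\<close> and misses the spectrum.\<close>
  have "finite {c. \<exists>v. v \<noteq> 0 \<and> ?H v = c *\<^sub>R v}"
    by (rule finite_eigenvalues_self_adjoint) (rule symH)
  then have "\<not> {\<nu><..<0} \<subseteq> {c. \<exists>v. v \<noteq> 0 \<and> ?H v = c *\<^sub>R v}"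
    using infinite_Ioo[OF \<open>\<nu> < 0\<close>] finite_subset by blast
  then obtain \<mu> where \<mu>: "\<nu> < \<mu>" "\<mu> < 0"
    and "\<mu> \<notin> {c. \<exists>v. v \<noteq> 0 \<and> ?H v = c *\<^sub>R v}"
    unfolding subset_iff greaterThanLessThan_iff by blast
  then have regular: "u = 0" if "?H u = \<mu> *\<^sub>R u" for u
    using that by blast

  define A where "A u = ?H u - \<mu> *\<^sub>R u" for u
  have lin: "linear A"
    unfolding A_def by (intro linear_compose_sub matrix_vector_mul_linear linear_scale_self)
  have sym: "u \<bullet> A v = A u \<bullet> v" for u v
    using symH by (simp add: A_def inner_diff_left inner_diff_right)
  have lower: "- (L + \<mu>) * (norm u)\<^sup>2 \<le> u \<bullet> A u" for u
  proof -
    have "\<bar>u \<bullet> ?H u\<bar> \<le> norm u * (L * norm u)"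
      using Cauchy_Schwarz_ineq2[of u "?H u"] mult_left_mono[OF boundH[of u], of "norm u"] by simp
    then show ?thesis
      by (simp add: A_def inner_diff_right power2_norm_eq_inner[symmetric] power2_eq_square algebra_simps)
  qed
  have "inj A"
    unfolding linear_injective_0[OF lin] using regular by (simp add: A_def)
  then obtain \<delta> where \<delta>: "\<delta> > 0" "\<And>u. \<delta> * norm u \<le> norm (A u)"
    using linear_inj_bounded_below_pos[OF lin] by blast
  obtain B where B: "B > 0" "\<And>u. norm (A u) \<le> B * norm u"
    using linear_bounded_pos[OF lin] by blast

  let ?b = "2 * B * (1 + \<sigma> * B) + \<sigma> * B"
  define \<epsilon> where "\<epsilon> = min 1 (2 * (1 - \<sigma> * L) * \<delta>\<^sup>2 / ?b)"
  have "0 < \<sigma> * B"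
    using \<open>\<sigma> > 0\<close> B by simp
  then have b: "?b > 0"
    using B \<open>\<sigma> > 0\<close> by (intro add_pos_pos mult_pos_pos) auto
  have \<epsilon>: "0 < \<epsilon>" "\<epsilon> \<le> 1"
    using b \<sigma> \<delta> by (auto simp: \<epsilon>_def)
  have "\<epsilon> \<le> 2 * (1 - \<sigma> * L) * \<delta>\<^sup>2 / ?b"
    by (simp add: \<epsilon>_def)
  then have small: "\<epsilon> * ?b \<le> 2 * (1 - \<sigma> * L) * \<delta>\<^sup>2"
    using b by (simp only: pos_le_divide_eq)
  have cont: "continuous_on UNIV (hessian f)"
    using \<open>C2 f\<close> by (simp add: C2_def)
  obtain r where "r > 0" and r: "\<And>y z. y \<in> ball x r \<Longrightarrow> z \<in> ball x r \<Longrightarrow>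
      norm (?F y - ?F z - ?H (y - z)) \<le> \<epsilon> * norm (y - z)"
    using derivative_error_small_near[OF der cont \<epsilon>(1)] by blast

  have "negligible ((\<lambda>x0. trajectory g x0 K) ` {x0. \<forall>k\<ge>K. trajectory g x0 k \<in> ball x r})" for K
  proof (rule negligible_outside_cone[OF lin sym])
    show "A v = (\<nu> - \<mu>) *\<^sub>R v" "v \<noteq> 0" "\<nu> - \<mu> < 0"
      using v \<mu> by (simp_all add: A_def algebra_simps)
    fix y z
    assume "y \<in> (\<lambda>x0. trajectory g x0 K) ` {x0. \<forall>k\<ge>K. trajectory g x0 k \<in> ball x r}"
      and "z \<in> (\<lambda>x0. trajectory g x0 K) ` {x0. \<forall>k\<ge>K. trajectory g x0 k \<in> ball x r}"
    then obtain y0 z0 where y: "y = trajectory g y0 K" "\<And>k. k \<ge> K \<Longrightarrow> trajectory g y0 k \<in> ball x r"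
      and z: "z = trajectory g z0 K" "\<And>k. k \<ge> K \<Longrightarrow> trajectory g z0 k \<in> ball x r"
      by blast
    define d where "d k = trajectory g y0 k - trajectory g z0 k" for k
    have "- (d K \<bullet> A (d K)) \<le> 0"
    proof (rule bounded_expanding_sequence_nonpos[OF div, where c = "- \<mu>"])
      show "0 < - \<mu>" "0 < \<alpha> k" for k
        using \<mu> \<alpha> by auto
      show "\<alpha> k * - \<mu> \<le> 1" for k
      proof -
        have "\<alpha> k * - \<mu> \<le> \<sigma> * L"
          using \<alpha>(1)[of k] \<alpha>(2)[of k] \<mu> \<open>- L \<le> \<nu>\<close> by (intro mult_mono) auto
        then show ?thesis
          using \<sigma> by linarith
      qed
    next
      fix k assume k: "k \<ge> K"
      let ?y = "trajectory g y0 (Suc k)" and ?z = "trajectory g z0 (Suc k)"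
      let ?e = "?F ?y - ?F ?z - ?H (d (Suc k))"
      have e: "norm ?e \<le> \<epsilon> * norm (d (Suc k))"
        unfolding d_def using k by (intro r y(2) z(2)) auto
      have "d k = (?y + \<alpha> k *\<^sub>R ?F ?y) - (?z + \<alpha> k *\<^sub>R ?F ?z)"
        unfolding d_def trajectory.simps(2) implicit by (rule refl)
      also have "\<dots> = d (Suc k) + \<alpha> k *\<^sub>R (?F ?y - ?F ?z)"
        by (simp add: d_def scaleR_diff_right)
      also have "?F ?y - ?F ?z = A (d (Suc k)) + \<mu> *\<^sub>R d (Suc k) + ?e"
        by (simp add: A_def)
      finally have dk: "d k = d (Suc k) + \<alpha> k *\<^sub>R (A (d (Suc k)) + \<mu> *\<^sub>R d (Suc k) + ?e)" .
      have "(1 + \<alpha> k * \<mu>)\<^sup>2 * (d (Suc k) \<bullet> A (d (Suc k))) \<le> d k \<bullet> A (d k)"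
        using \<mu> \<open>- L \<le> \<nu>\<close> B(1) \<delta>(1) L \<epsilon>
        by (intro implicit_step_expands_form[OF lin sym lower B(2) _ \<delta>(2) _ _ _ \<alpha>(1) \<alpha>(2) \<sigma> _ e _ _ small dk]) auto
      then show "- (d k \<bullet> A (d k)) \<le> (1 - \<alpha> k * - \<mu>)\<^sup>2 * - (d (Suc k) \<bullet> A (d (Suc k)))"
        by simp
    next
      fix k assume k: "k \<ge> K"
      have "norm (d k) \<le> 2 * r"
        using y(2)[OF k] z(2)[OF k] dist_triangle2[of "trajectory g y0 k" "trajectory g z0 k" x]
        by (simp add: d_def dist_norm[symmetric] dist_commute)
      then have "norm (A (d k)) \<le> B * (2 * r)"
        using B(1) B(2)[of "d k"] mult_left_mono[of "norm (d k)" "2 * r" B] by linarith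
      have "- (d k \<bullet> A (d k)) \<le> norm (d k) * norm (A (d k))"
        using Cauchy_Schwarz_ineq2[of "d k" "A (d k)"] by linarith
      also have "\<dots> \<le> (2 * r) * (B * (2 * r))"
        using \<open>norm (d k) \<le> 2 * r\<close> \<open>norm (A (d k)) \<le> B * (2 * r)\<close> \<open>r > 0\<close>
        by (intro mult_mono) auto
      finally show "- (d k \<bullet> A (d k)) \<le> (2 * r) * (B * (2 * r))" .
    qed
    then show "0 \<le> (y - z) \<bullet> A (y - z)"
      by (simp add: y(1) z(1) d_def)
  qed
  then show ?thesis
    using that[OF \<open>r > 0\<close>] by blast
qed

text \<open>Neighbourhoods rather than points of \<open>S\<close> are treated one at a time: by the Lindelof property countably many
of them cover \<open>S\<close>, and a convergent trajectory eventually stays in the one around its limit.\<close>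

lemma avoids_if_locally_negligible:
  fixes g G :: "nat \<Rightarrow> real ^ 'n \<Rightarrow> real ^ 'n"
  assumes left_inverse: "\<And>k x. G k (g k x) = x"
    and lip: "\<And>k. (C k)-lipschitz_on UNIV (G k)"
    and local: "\<And>x. x \<in> S \<Longrightarrow> \<exists>r>0. \<forall>K. negligible
      ((\<lambda>x0. trajectory g x0 K) ` {x0. \<forall>k\<ge>K. trajectory g x0 k \<in> ball x r})"
  shows "avoids g S"
proof -
  let ?W = "\<lambda>U K. {x0. \<forall>k\<ge>K. trajectory g x0 k \<in> U}"
  let ?\<U> = "{U. open U \<and> (\<forall>K. negligible ((\<lambda>x0. trajectory g x0 K) ` ?W U K))}"
  have "S \<subseteq> \<Union>?\<U>"
  proof
    fix x assume "x \<in> S"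
    then obtain r where "r > 0" "\<forall>K. negligible ((\<lambda>x0. trajectory g x0 K) ` ?W (ball x r) K)"
      using local by blast
    then have "ball x r \<in> ?\<U>" "x \<in> ball x r"
      by auto
    then show "x \<in> \<Union>?\<U>"
      by blast
  qed
  moreover obtain \<V> where \<V>: "\<V> \<subseteq> ?\<U>" "countable \<V>" "\<Union>\<V> = \<Union>?\<U>"
    by (rule Lindelof[of ?\<U>]) auto
  ultimately have cover: "S \<subseteq> \<Union>\<V>"
    by simp
  have "negligible (?W U K)" if "U \<in> \<V>" for U K
  proof -
    have "negligible {x0. trajectory g x0 K \<in> (\<lambda>x0. trajectory g x0 K) ` ?W U K}"
      using that \<V> by (intro negligible_trajectory_preimage[OF left_inverse lip]) blast
    then show ?thesis
      by (rule negligible_subset) blast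
  qed
  then have "negligible (\<Union>U\<in>\<V>. \<Union>K. ?W U K)"
    using \<V>(2) by (intro negligible_countable_Union) auto
  moreover have "{x0. \<exists>x\<in>S. trajectory g x0 \<longlonglongrightarrow> x} \<subseteq> (\<Union>U\<in>\<V>. \<Union>K. ?W U K)"
  proof clarify
    fix x0 x assume "x \<in> S" and lim: "trajectory g x0 \<longlonglongrightarrow> x"
    then obtain U where U: "U \<in> \<V>" "x \<in> U" "open U"
      using cover \<V>(1) by blast
    then obtain K where "\<forall>k\<ge>K. trajectory g x0 k \<in> U"
      using topological_tendstoD[OF lim] unfolding eventually_sequentially by blast
    then show "x0 \<in> (\<Union>U\<in>\<V>. \<Union>K. ?W U K)"
      using U by blast
  qed
  ultimately show ?thesis
    unfolding avoids_def negligible_iff_null_sets[symmetric] by (rule negligible_subset)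
qed

theorem theorem7p1:
  fixes f :: "real ^ 'n \<Rightarrow> real" and L :: real and \<alpha> :: "nat \<Rightarrow> real"
  assumes "C2 f"
    and "L > 0"
    and "L-lipschitz_on UNIV (grad f)"
    and "\<And>k. \<alpha> k \<in> {0<..<1 / L}"
    and "(SUP k. \<alpha> k) < 1 / L"
    and "filterlim (\<lambda>n. \<Sum>k<n. \<alpha> k) at_top sequentially"
  shows "avoids (\<lambda>k. prox_step f (\<alpha> k)) {x. strict_saddle f x}"
proof -
  let ?g = "\<lambda>k. prox_step f (\<alpha> k)" and ?\<sigma> = "SUP k. \<alpha> k"
  let ?G = "\<lambda>k x. x + \<alpha> k *\<^sub>R grad f x"
  have pos: "0 < \<alpha> k" and lt: "\<alpha> k < 1 / L" for k
    using assms(4)[of k] by auto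
  have "bdd_above (range \<alpha>)"
    by (rule bdd_aboveI2[where M = "1 / L"]) (rule less_imp_le[OF lt])
  then have le: "\<alpha> k \<le> ?\<sigma>" for k
    by (rule cSUP_upper[OF UNIV_I])
  have \<sigma>: "?\<sigma> * L < 1"
    using assms(2,5) by (simp only: pos_less_divide_eq)
  have "\<alpha> k * L < 1" for k
    using lt[of k] assms(2) by (simp only: pos_less_divide_eq)
  moreover have "GDERIV f x :> grad f x" for x
    using assms(1) by (intro GDERIV_grad) (simp add: C2_def)
  ultimately have implicit: "?G k (?g k x) = x" for k x
    using assms(3) pos by (intro prox_step_implicit)
  show ?thesis
  proof (rule avoids_if_locally_negligible[where g = ?g and G = ?G, OF implicit])
    show "(1 + \<bar>\<alpha> k\<bar> * L)-lipschitz_on UNIV (?G k)" for k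
      by (intro lipschitz_intros assms(3))
  next
    fix x assume "x \<in> {x. strict_saddle f x}"
    then have "strict_saddle f x"
      by simp
    obtain r where "r > 0" "\<And>K. negligible
        ((\<lambda>x0. trajectory ?g x0 K) ` {x0. \<forall>k\<ge>K. trajectory ?g x0 k \<in> ball x r})"
      by (rule trajectories_near_strict_saddle_negligible[of f L \<alpha> ?\<sigma> ?g x])
        (use assms(1-3,6) pos le \<sigma> implicit \<open>strict_saddle f x\<close> in \<open>simp_all only:\<close>)
    then show "\<exists>r>0. \<forall>K. negligible
        ((\<lambda>x0. trajectory ?g x0 K) ` {x0. \<forall>k\<ge>K. trajectory ?g x0 k \<in> ball x r})"
      by blast
  qed
qed

end
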